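(* Let $\mathbf{V}=(V_1,\dots,V_m)$ follow a GPD copula on $[-1,0]^m$, and let $\mathbf{x}_0=(x_0^{(1)},\dots,x_0^{(m)})<\mathbf{0}$ and a Pickands dependence function $D$ be such that $$P(\mathbf{V}\le\mathbf{x})=1+\Big(\sum_{i\le m}x_i\Big)D\Big(\frac{x_1}{\sum_{i\le m}x_i},\dots,\frac{x_{m-1}}{\sum_{i\le m}x_i}\Big),\qquad \mathbf{x}\in[\mathbf{x}_0,\mathbf{0}].$$ Let $\mathbf{Y}=(Y_1,\dots,Y_m)$ follow an arbitrary copula $C$ on $[-1,0]^m$ and be independent of $\mathbf{V}$. Let $\mathbf{y}=(y_1,\dots,y_m)\in[-1,0]^m$ satisfy $P(\mathbf{Y}>\mathbf{y})>0$, and put $$Q_i:=Y_i\,1_{(Y_i\le y_i)}-y_iV_i\,1_{(Y_i>y_i)},\qquad i\le m.$$ Then: (1) each $Q_i$ follows the uniform distribution on $[-1,0]$; (2) the random vector $\mathbf{Q}=(Q_1,\dots,Q_m)$ follows a GPD copula on $[-1,0]^m$, which coincides with $C$ on $\times_{i\le m}[-1,y_i]$, that is, $P(\mathbf{Q}\le\mathbf{x})=C(\mathbf{x})$ for $\mathbf{x}\le\mathbf{y}$; (3) for any non-empty subset $K$ of $\{1,\dots,m\}$ and any $x_i\in[\max(y_i,x_0^{(i)}),0]$, $i\le m$, $$P(Q_i\ge x_i,\ i\in K)=P(V_i\ge b_{i,K}x_i,\ i\in K),$$ where $$b_{i,K}:=\frac{P(Y_j>y_j,\ j\in K)}{-y_i}=\frac{P(Y_j>y_j,\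 j\in K)}{P(Y_i>y_i)}\in(0,1],\qquad i\in K.$$
   Context: Operations and inequalities between vectors are componentwise; $\mathbf{0}=(0,\dots,0)$; $1_{A}$ is the indicator of the event $A$. A copula on $[-1,0]^m$ is a distribution function on $\mathbb{R}^m$ each of whose univariate margins is uniform on $[-1,0]$. Extreme value distribution (EVD): a distribution function $G$ on $\mathbb{R}^m$ with non-degenerate margins that is max-stable, i.e. for every $n\in\mathbb{N}$ there are $\mathbf{c}_n>\mathbf{0}$, $\mathbf{d}_n\in\mathbb{R}^m$ with $G^n(\mathbf{c}_n\mathbf{x}+\mathbf{d}_n)=G(\mathbf{x})$ for all $\mathbf{x}$. Standard negative exponential margins means $G_i(x)=\exp(x)$, $x\le0$. Pickands dependence function: a function $D$ on $\{\mathbf{u}\in[0,1]^{m-1}:\sum_{j\le m-1}u_j\le1\}$ of the form $$D(u_1,\dots,u_{m-1})=\int_{S_m}\max(u_1t_1,\dots,u_{m-1}t_{m-1},u_mt_m)\,\mu(d\mathbf{t}),\quad u_m:=1-\sum_{j\le m-1}u_j,$$ where $S_m=\{\mathbf{t}\ge\mathbf{0}:\sum_{i\le m}t_i=1\}$ and $\mu$ is a finite measure on $S_m$ with $\int_{S_m}t_i\,\mu(d\mathbf{t})=1$ for all $i\le m$. The expression $1+(\sum x_i)D(\cdot)$ is read as $1$ at $\mathbf{x}=\mathbf{0}$. GPD copula on $[-1,0]^m$: a copula on $[-1,0]^m$ that coincides near $\mathbf{0}$ with a generalized Pareto distribution (GPD) having standard uniform margins near $\mathbf{0}$, i.e. there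 are $\mathbf{x}_0<\mathbf{0}$ and an EVD $G$ with standard negative exponential margins such that the copula equals $1+\log(G(\mathbf{x}))$ for all $\mathbf{x}\in[\mathbf{x}_0,\mathbf{0}]$; equivalently, it equals $1+(\sum_{i\le m}x_i)D(x_1/\sum_{i\le m}x_i,\dots,x_{m-1}/\sum_{i\le m}x_i)$ on $[\mathbf{x}_0,\mathbf{0}]$ for some Pickands dependence function $D$.
   Formalization: Part (3) is false on the printed range (e.g. V=(U,-1-U), Y=(Z,Z), y=x=x_0=(-1/2,-1/2), K={1,2}); the formal version additionally requires x_i >= -y_i x_0^{(i)} for i in K, and the one-element K case on the full range follows from (1). *)

theory Defs
  imports "HOL-Probability.Probability"
begin

text \<open>
  Coordinates are indexed by a finite type \<open>'m\<close>, so that $m$ is \<open>CARD('m)\<close>.  On \<open>real ^ 'm\<close>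
  the library's \<open>\<le>\<close> and closed intervals are componentwise, but \<open><\<close> is not (it only means
  \<open>\<le>\<close> and \<open>\<noteq>\<close>); strict componentwise inequalities are therefore spelled out below.
\<close>

definition joint_distribution :: "(real ^ 'm) measure \<Rightarrow> bool" where
  "joint_distribution \<mu> \<longleftrightarrow> prob_space \<mu> \<and> sets \<mu> = sets borel"

definition joint_cdf :: "(real ^ 'm) measure \<Rightarrow> real ^ 'm \<Rightarrow> real" where
  "joint_cdf \<mu> x = measure \<mu> {..x}"

definition margin :: "(real ^ 'm) measure \<Rightarrow> 'm \<Rightarrow> real measure" where
  "margin \<mu> i = distr \<mu> borel (\<lambda>z. z $ i)"

definition copula :: "(real ^ 'm \<Rightarrow> real) \<Rightarrow> bool" where
  "copula C \<longleftrightarrow>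
     (\<exists>\<mu>. joint_distribution \<mu> \<and> C = joint_cdf \<mu> \<and>
          (\<forall>i. margin \<mu> i = uniform_measure lborel {-1..0}))"

text \<open>The products \<open>c * x\<close> of vectors are componentwise.\<close>

definition max_stable :: "(real ^ 'm \<Rightarrow> real) \<Rightarrow> bool" where
  "max_stable G \<longleftrightarrow>
     (\<forall>n\<ge>1. \<exists>c d. (\<forall>i. c $ i > 0) \<and> (\<forall>x. G (c * x + d) ^ n = G x))"

definition extreme_value_distribution :: "(real ^ 'm) measure \<Rightarrow> bool" where
  "extreme_value_distribution \<nu> \<longleftrightarrow>
     joint_distribution \<nu> \<and>
     (\<forall>i. \<nexists>a. margin \<nu> i = return borel a) \<and>
     max_stable (joint_cdf \<nu>)"

definition standard_neg_exp_margins :: "(real ^ 'm) measure \<Rightarrow> bool" where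
  "standard_neg_exp_margins \<nu> \<longleftrightarrow> (\<forall>i. \<forall>t\<le>0. cdf (margin \<nu> i) t = exp t)"

definition gpd_copula :: "(real ^ 'm \<Rightarrow> real) \<Rightarrow> bool" where
  "gpd_copula C \<longleftrightarrow>
     copula C \<and>
     (\<exists>x0 \<nu>. (\<forall>i. x0 $ i < 0) \<and>
        extreme_value_distribution \<nu> \<and> standard_neg_exp_margins \<nu> \<and>
        (\<forall>x\<in>{x0..0}. C x = 1 + ln (joint_cdf \<nu> x)))"

definition std_simplex :: "(real ^ 'm) set" where
  "std_simplex = {t. (\<forall>i. 0 \<le> t $ i) \<and> (\<Sum>i\<in>UNIV. t $ i) = 1}"

text \<open>
  In the Pickands representation one coordinate, called \<open>l\<close> here (the $m$-th coordinate), is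
  singled out.  The point $(u_1,\dots,u_{m-1})$ is a family indexed by the remaining coordinates
  \<open>- {l}\<close>, extensional in the sense of \<open>PiE\<close>.
\<close>

definition pickands_domain :: "'m::finite \<Rightarrow> ('m \<Rightarrow> real) set" where
  "pickands_domain l = {u \<in> (- {l}) \<rightarrow>\<^sub>E {0..1}. (\<Sum>j\<in>- {l}. u j) \<le> 1}"

definition add_last_coord :: "'m::finite \<Rightarrow> ('m \<Rightarrow> real) \<Rightarrow> 'm \<Rightarrow> real" where
  "add_last_coord l u = u(l := 1 - (\<Sum>j\<in>- {l}. u j))"

definition pickands_dependence_function :: "'m::finite \<Rightarrow> (('m \<Rightarrow> real) \<Rightarrow> real) \<Rightarrow> bool" where
  "pickands_dependence_function l D \<longleftrightarrow>
     (\<exists>\<mu> :: (real ^ 'm) measure.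
        finite_measure \<mu> \<and> sets \<mu> = sets (restrict_space borel std_simplex) \<and>
        (\<forall>i. (\<integral>t. t $ i \<partial>\<mu>) = 1) \<and>
        (\<forall>u\<in>pickands_domain l. D u = (\<integral>t. (MAX i. add_last_coord l u i * t $ i) \<partial>\<mu>)))"

text \<open>At \<open>x = 0\<close> the following is 1, whatever the value of \<open>D\<close>.\<close>

definition gpd_form :: "'m::finite \<Rightarrow> (('m \<Rightarrow> real) \<Rightarrow> real) \<Rightarrow> real ^ 'm \<Rightarrow> real" where
  "gpd_form l D x =
     (let s = (\<Sum>i\<in>UNIV. x $ i) in 1 + s * D (\<lambda>j\<in>- {l}. x $ j / s))"

end

theory Submission
  imports Defs
begin

text \<open>
  Splitting by the random set of coordinates with \<open>Y $ i > y $ i\<close>, which is independent of \<open>V\<close>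
  and equals \<open>T\<close> with probability \<open>p T\<close>, gives for \<open>x \<ge> y\<close>
  \[P(Q \<le> x) = \sum_T p_T\, P(V_i \<le> x_i / (-y_i),\ i \<in> T).\]
  Near 0 each factor on the right is \<open>1 + ln G\<close> for an extreme value distribution \<open>G\<close>, evaluated
  at the point \<open>v\<close> with coordinates \<open>x $ i / - y $ i\<close> on \<open>T\<close> and 0 elsewhere.  By the Pickands
  form \<open>ln G\<close> is homogeneous near 0, so \<open>p T * ln (G v) = ln (G (p T *\<^sub>R v))\<close>, and the sum becomes
  \<open>1 + ln H x\<close> with \<open>H\<close> a product of rescaled copies of \<open>G\<close>.  This \<open>H\<close> is realized as the
  distribution of a componentwise maximum of independent rescaled vectors with distribution \<open>G\<close>;
  every margin takes part in it because \<open>p UNIV > 0\<close>.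

  The joint survival probabilities of \<open>V\<close> are signed sums of values of the Pickands form whose
  constant terms cancel, hence homogeneous of degree 1 near 0.  This moves the factor
  \<open>P(Y $ j > y $ j, j \<in> K)\<close> of the survival probability of \<open>Q\<close> into the argument.
\<close>

subsection \<open>Joint distributions and uniform margins\<close>

lemma borel_measurable_vec_nth [measurable]:
  "(\<lambda>z::real ^ 'm. z $ i) \<in> borel_measurable borel"
  by (intro borel_measurable_continuous_onI continuous_intros)

lemma borel_measurable_vecI:
  fixes f :: "'a \<Rightarrow> real ^ 'm"
  assumes "\<And>i. (\<lambda>\<omega>. f \<omega> $ i) \<in> borel_measurable M"
  shows "f \<in> borel_measurable M"
  using assms by (subst borel_measurable_euclidean_space) (auto simp: Basis_vec_def inner_axis)

text \<open>Lower orthants form an intersection-stable generator of the Borel sets, so the joint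
  distribution function determines the measure.\<close>

lemma joint_distribution_eqI:
  fixes \<mu> \<nu> :: "(real ^ 'm) measure"
  assumes \<mu>: "joint_distribution \<mu>" and \<nu>: "joint_distribution \<nu>"
    and eq: "\<And>x. joint_cdf \<mu> x = joint_cdf \<nu> x"
  shows "\<mu> = \<nu>"
proof -
  interpret M: prob_space \<mu> using \<mu> by (simp add: joint_distribution_def)
  interpret N: prob_space \<nu> using \<nu> by (simp add: joint_distribution_def)
  have borel: "sets (borel :: (real ^ 'm) measure) = sigma_sets UNIV (range (\<lambda>a. {..a}))"
    by (subst borel_eq_atMost) simp
  show ?thesis
  proof (rule measure_eqI_generator_eq[where E = "range (\<lambda>a. {..a})" and \<Omega> = UNIV
        and A = "\<lambda>n. {..\<chi> i. real n}"])
    have "{..a} \<inter> {..b} = {..\<chi> i. min (a $ i) (b $ i)}" for a b :: "real ^ 'm"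
      by (auto simp: less_eq_vec_def)
    then show "Int_stable (range (\<lambda>a::real ^ 'm. {..a}))"
      by (auto simp: Int_stable_def)
    show "emeasure \<mu> X = emeasure \<nu> X" if "X \<in> range (\<lambda>a. {..a})" for X
      using that eq by (auto simp: joint_cdf_def M.emeasure_eq_measure N.emeasure_eq_measure)
    show "(\<Union>n. {..\<chi> i. real n}) = (UNIV :: (real ^ 'm) set)"
    proof safe
      fix x :: "real ^ 'm"
      obtain n where n: "Max (range (($) x)) \<le> real n"
        using real_arch_simple by blast
      have "x $ i \<le> real n" for i
        using n by (meson Max_ge finite_class.finite_UNIV finite_imageI order_trans rangeI)
      then show "x \<in> (\<Union>n. {..\<chi> i. real n})" by (auto simp: less_eq_vec_def)
    qed auto
  qed (use \<mu> \<nu> borel in \<open>simp_all add: joint_distribution_def image_subset_iff\<close>)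
qed

lemma cdf_margin:
  assumes "joint_distribution \<mu>"
  shows "cdf (margin \<mu> i) t = measure \<mu> {z. z $ i \<le> t}"
proof -
  have sets: "sets \<mu> = sets borel"
    using assms by (simp add: joint_distribution_def)
  have "(\<lambda>z. z $ i) \<in> borel_measurable \<mu>"
    by (subst measurable_cong_sets[OF sets refl]) (rule borel_measurable_vec_nth)
  then show ?thesis
    unfolding cdf_def margin_def
    by (subst measure_distr) (auto simp: sets_eq_imp_space_eq[OF sets] vimage_def)
qed

lemma cdf_uniform_measure_Icc:
  "cdf (uniform_measure lborel {-1..0}) t = max 0 (min 1 (1 + t))"
proof -
  have "{-1..0} \<inter> {..t} = {-1..min 0 t}" by auto
  then show ?thesis by (simp add: cdf_def max_def min_def)
qed

text \<open>The values 0 at -1 and 1 at 0 already fix the distribution function outside the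
  interval, by monotonicity.\<close>

lemma (in prob_space) distr_eq_uniform_measure_IccI:
  assumes [measurable]: "random_variable borel X"
    and X: "\<And>t. t \<in> {-1..0} \<Longrightarrow> prob {\<omega> \<in> space M. X \<omega> \<le> t} = 1 + t"
  shows "distr M borel X = uniform_measure lborel {-1..0::real}"
proof (rule cdf_unique)
  show "real_distribution (distr M borel X)" by (rule real_distribution_distr) simp
  show "real_distribution (uniform_measure lborel {-1..0::real})"
    by (auto simp: real_distribution_def real_distribution_axioms_def intro!: prob_space_uniform_measure)
  show "cdf (distr M borel X) = cdf (uniform_measure lborel {-1..0::real})"
  proof
    fix t :: real
    have mono: "prob {\<omega> \<in> space M. X \<omega> \<le> s} \<le> prob {\<omega> \<in> space M. X \<omega> \<le> t}" if "s \<le> t" for s t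
      using that by (intro finite_measure_mono) auto
    have "prob {\<omega> \<in> space M. X \<omega> \<le> t} = max 0 (min 1 (1 + t))"
    proof -
      consider "t < -1" | "t \<in> {-1..0}" | "t > 0" by fastforce
      then show ?thesis
      proof cases
        case 1
        then show ?thesis using mono[of t "-1"] X[of "-1"] by (auto simp: measure_le_0_iff)
      next
        case 2
        then show ?thesis using X[of t] by auto
      next
        case 3
        then show ?thesis using mono[of 0 t] X[of 0] prob_le_1[of "{\<omega> \<in> space M. X \<omega> \<le> t}"] by auto
      qed
    qed
    then show "cdf (distr M borel X) t = cdf (uniform_measure lborel {-1..0::real}) t"
      by (simp add: cdf_uniform_measure_Icc) (simp add: cdf_def measure_distr vimage_def Int_def conj_commute)
  qed
qed

locale uniform_Icc_variable = prob_space M for M :: "'a measure" +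
  fixes X :: "'a \<Rightarrow> real"
  assumes measurable_X [measurable]: "X \<in> borel_measurable M"
    and distr_X: "distr M borel X = uniform_measure lborel {-1..0}"
begin

lemma prob_le: "prob {\<omega> \<in> space M. X \<omega> \<le> t} = max 0 (min 1 (1 + t))"
proof -
  have "prob {\<omega> \<in> space M. X \<omega> \<le> t} = cdf (distr M borel X) t"
    by (simp add: cdf_def measure_distr vimage_def Int_def conj_commute)
  then show ?thesis by (simp add: distr_X cdf_uniform_measure_Icc)
qed

text \<open>The left end carries no mass, hence the strict bound; it later keeps
  \<open>- y $ i * V \<omega> $ i\<close> strictly above \<open>y $ i\<close>.\<close>

lemma AE_in_Ioo: "AE \<omega> in M. -1 < X \<omega> \<and> X \<omega> \<le> 0"
proof -
  have "AE \<omega> in M. X \<omega> \<le> 0"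
    using prob_le[of 0] by (intro AE_I_eq_1) (auto simp: emeasure_eq_measure)
  moreover have "AE \<omega> in M. \<not> X \<omega> \<le> -1"
    using prob_le[of "-1"] by (intro AE_I[where N = "{\<omega> \<in> space M. X \<omega> \<le> -1}"]) (auto simp: emeasure_eq_measure)
  ultimately show ?thesis by eventually_elim auto
qed

lemma AE_neq: "AE \<omega> in M. X \<omega> \<noteq> t"
proof -
  have "AE z in uniform_measure lborel {-1..0}. z \<noteq> t"
    using AE_lborel_singleton[of t] by (intro AE_uniform_measureI) (auto elim!: eventually_mono)
  then show ?thesis
    unfolding distr_X[symmetric] by (subst (asm) AE_distr_iff) auto
qed

lemma prob_greater: "prob {\<omega> \<in> space M. X \<omega> > t} = 1 - max 0 (min 1 (1 + t))"
proof -
  have "{\<omega> \<in> space M. X \<omega> > t} = space M - {\<omega> \<in> space M. X \<omega> \<le> t}" by auto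
  then show ?thesis using prob_le[of t] by (simp add: prob_compl)
qed

end

subsection \<open>Extreme value distributions with standard negative exponential margins\<close>

locale neg_exp_evd =
  fixes \<nu> :: "(real ^ 'm) measure"
  assumes evd: "extreme_value_distribution \<nu>" and margins: "standard_neg_exp_margins \<nu>"
begin

lemma joint_distribution: "joint_distribution \<nu>"
  using evd by (simp add: extreme_value_distribution_def)

sublocale prob_space \<nu>
  using joint_distribution by (simp add: joint_distribution_def)

lemma sets_eq [measurable_cong]: "sets \<nu> = sets borel"
  using joint_distribution by (simp add: joint_distribution_def)

lemma space_eq [simp]: "space \<nu> = UNIV"
  using sets_eq_imp_space_eq[OF sets_eq] by simp

lemma prob_coord_le: "t \<le> 0 \<Longrightarrow> prob {z. z $ i \<le> t} = exp t"
  using margins cdf_margin[OF joint_distribution] by (simp add: standard_neg_exp_margins_def)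

lemma AE_nonpos: "AE z in \<nu>. \<forall>i. z $ i \<le> 0"
proof (subst AE_all_countable, intro allI)
  fix i
  have "AE z in \<nu>. z \<in> {z. z $ i \<le> 0}"
    using prob_coord_le[of 0 i] by (intro AE_prob_1) auto
  then show "AE z in \<nu>. z $ i \<le> 0" by simp
qed

lemma joint_cdf_eq: "joint_cdf \<nu> x = prob {z. \<forall>i. z $ i \<le> x $ i}"
  by (simp add: joint_cdf_def atMost_def less_eq_vec_def)

text \<open>The law lives on nonpositive vectors, so nonnegative bounds impose nothing and a single
  margin remains; \<open>min\<close> covers a positive \<open>x $ i\<close>.\<close>

lemma joint_cdf_single:
  assumes "\<And>j. j \<noteq> i \<Longrightarrow> 0 \<le> x $ j"
  shows "joint_cdf \<nu> x = exp (min 0 (x $ i))"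
proof -
  have "joint_cdf \<nu> x = prob {z. z $ i \<le> min 0 (x $ i)}"
    unfolding joint_cdf_eq
  proof (rule measure_eq_AE)
    show "AE z in \<nu>. z \<in> {z. \<forall>i. z $ i \<le> x $ i} \<longleftrightarrow> z \<in> {z. z $ i \<le> min 0 (x $ i)}"
      using AE_nonpos by eventually_elim (use assms in \<open>fastforce intro: order_trans\<close>)
  qed measurable
  then show ?thesis by (simp only: prob_coord_le min.cobounded1)
qed

lemma joint_cdf_0 [simp]: "joint_cdf \<nu> 0 = 1"
  using joint_cdf_single[of undefined 0] by simp

text \<open>Max-stability only supplies unknown norming vectors; the standard negative exponential
  margins force \<open>c $ i = 1 / n\<close> and \<open>d $ i = 0\<close>.\<close>

lemma joint_cdf_scale:
  assumes "n \<ge> 1"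
  shows "joint_cdf \<nu> (x /\<^sub>R real n) ^ n = joint_cdf \<nu> x"
proof -
  obtain c d where c: "\<And>i. c $ i > 0" and cd: "\<And>x. joint_cdf \<nu> (c * x + d) ^ n = joint_cdf \<nu> x"
    using evd assms unfolding extreme_value_distribution_def max_stable_def by metis
  have *: "real n * min 0 (c $ i * t + d $ i) = min 0 t" for i t
  proof -
    \<comment> \<open>The other coordinates are large enough that \<open>x $ j\<close> and
      \<open>c $ j * x $ j + d $ j\<close> are both nonnegative, which isolates margin
      \<open>i\<close> on either side.\<close>
    define x where "x = (\<chi> j. if j = i then t else max 0 (- d $ j / c $ j))"
    have "0 \<le> (c * x + d) $ j" if "j \<noteq> i" for j
      using c[of j] that by (auto simp: x_def max_def field_simps)
    then have "joint_cdf \<nu> (c * x + d) = exp (min 0 (c $ i * t + d $ i))"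
      by (subst joint_cdf_single[of i]) (auto simp: x_def)
    moreover have "joint_cdf \<nu> x = exp (min 0 t)"
      by (subst joint_cdf_single[of i]) (auto simp: x_def)
    ultimately have "exp (real n * min 0 (c $ i * t + d $ i)) = exp (min 0 t)"
      using cd[of x] by (simp add: exp_of_nat_mult)
    then show ?thesis by simp
  qed
  have "c $ i = 1 / real n \<and> d $ i = 0" for i
  proof -
    have n: "real n > 0" using assms by simp
    have "min 0 (c $ i * t + d $ i) = min 0 t / n" for t
      using *[of i t] n by (simp only: eq_divide_eq mult.commute) simp
    \<comment> \<open>At -1 and -2 the right-hand side is negative, so \<open>min\<close> is
      inactive and two points determine the affine map.\<close>
    from this[of "-1"] this[of "-2"]
    have "min 0 (c $ i * -1 + d $ i) = -1 / n" "min 0 (c $ i * -2 + d $ i) = -2 / n"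
      by simp_all
    moreover have "-1 / real n < 0" "-2 / real n < 0" using n by auto
    ultimately have "- c $ i + d $ i = -1 / n" "-2 * c $ i + d $ i = -2 / n"
      by (auto simp: min_def split: if_splits)
    then show ?thesis by (auto simp: field_simps)
  qed
  then have "c * x + d = x /\<^sub>R real n" by (auto simp: vec_eq_iff divide_inverse)
  then show ?thesis using cd[of x] by simp
qed

text \<open>Union bound together with \<open>1 - exp t \<le> - t\<close>. Positivity is what later
  allows a sum of logarithms to become the logarithm of a product.\<close>

lemma joint_cdf_pos:
  assumes x: "\<And>i. x $ i \<le> 0" and lower: "\<And>i. - 1 / CARD('m) < x $ i"
  shows "joint_cdf \<nu> x > 0"
proof -
  have "1 - joint_cdf \<nu> x = prob (\<Union>i. {z. z $ i > x $ i})"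
  proof -
    have "(\<Union>i. {z. z $ i > x $ i}) = space \<nu> - {z. \<forall>i. z $ i \<le> x $ i}"
      by (auto simp flip: not_le)
    then show ?thesis
      by (simp only:) (subst prob_compl, simp_all add: joint_cdf_eq)
  qed
  also have "\<dots> \<le> (\<Sum>i\<in>UNIV. prob {z. z $ i > x $ i})"
    by (intro finite_measure_subadditive_finite) (auto simp: sets_eq)
  also have "\<dots> = (\<Sum>i\<in>UNIV. 1 - exp (x $ i))"
  proof (intro sum.cong refl)
    fix i
    have "prob {z. z $ i > x $ i} = prob (space \<nu> - {z. z $ i \<le> x $ i})"
      by (auto intro!: arg_cong[where f = prob])
    then show "prob {z. z $ i > x $ i} = 1 - exp (x $ i)"
      using x[of i] by (subst (asm) prob_compl) (auto simp: prob_coord_le)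
  qed
  also have "\<dots> < (\<Sum>i\<in>(UNIV :: 'm set). 1 / CARD('m))"
  proof (rule sum_strict_mono)
    fix i
    show "1 - exp (x $ i) < 1 / CARD('m)"
      using exp_ge_add_one_self[of "x $ i"] lower[of i] by (simp only: minus_divide_left)
  qed auto
  finally show ?thesis by simp
qed

end

text \<open>The product is the distribution function of a componentwise maximum of independent
  rescaled copies. Weights summing to 1 preserve the margins, and scaling by \<open>1 / n\<close>
  passes through every factor, which gives max-stability.\<close>

lemma exists_neg_exp_evd_prod:
  fixes \<nu> :: "(real ^ 'm) measure" and w :: "'t::finite \<Rightarrow> real ^ 'm"
  assumes "neg_exp_evd \<nu>"
    and w: "\<And>t i. w t $ i \<ge> 0" and sum_w: "\<And>i. (\<Sum>t\<in>UNIV. w t $ i) = 1"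
  obtains \<nu>' where "neg_exp_evd \<nu>'" "\<And>x. joint_cdf \<nu>' x = (\<Prod>t\<in>UNIV. joint_cdf \<nu> (w t * x))"
proof -
  interpret neg_exp_evd \<nu> by fact
  interpret P: prob_space "\<Pi>\<^sub>M t\<in>(UNIV :: 't set). \<nu>"
    by (intro prob_space_PiM) unfold_locales
  \<comment> \<open>A copy of weight 0 in coordinate \<open>i\<close> would sit at minus infinity
    and is left out of the maximum; the index set stays nonempty because the weights sum to
    1.\<close>
  define Z where "Z \<omega> = (\<chi> i. MAX t\<in>{t. w t $ i > 0}. \<omega> t $ i / w t $ i)" for \<omega> :: "'t \<Rightarrow> real ^ 'm"
  define \<nu>' where "\<nu>' = distr (\<Pi>\<^sub>M t\<in>(UNIV :: 't set). \<nu>) borel Z"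
  have ne: "{t. w t $ i > 0} \<noteq> {}" for i
    using sum_w[of i] w by (metis (mono_tags, lifting) Collect_empty_eq less_eq_real_def sum.neutral zero_neq_one)
  have [measurable]: "Z \<in> borel_measurable (\<Pi>\<^sub>M t\<in>(UNIV :: 't set). \<nu>)"
    unfolding Z_def
    by (intro borel_measurable_vecI) (simp, measurable)
  have jd: "joint_distribution \<nu>'"
    unfolding joint_distribution_def \<nu>'_def by (auto intro!: P.prob_space_distr)
  have cdf: "joint_cdf \<nu>' x = (\<Prod>t\<in>UNIV. joint_cdf \<nu> (w t * x))" for x
  proof -
    \<comment> \<open>Coordinates of weight 0 are unconstrained here; in \<open>w t * x\<close> they
      give the bound 0, which holds almost surely. So \<open>B t\<close> still has probability
      \<open>joint_cdf \<nu> (w t * x)\<close>.\<close>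
    define B where "B t = {z. \<forall>i. w t $ i > 0 \<longrightarrow> z $ i \<le> w t $ i * x $ i}" for t
    have B [measurable]: "B t \<in> sets \<nu>" for t unfolding B_def sets_eq by measurable
    have "Z \<omega> \<le> x \<longleftrightarrow> (\<forall>t. \<omega> t \<in> B t)" for \<omega>
      using ne by (auto simp: Z_def less_eq_vec_def B_def field_simps)
    then have "joint_cdf \<nu>' x = measure (\<Pi>\<^sub>M t\<in>(UNIV :: 't set). \<nu>) (Pi\<^sub>E UNIV B)"
      unfolding joint_cdf_def \<nu>'_def
      by (subst measure_distr) (auto intro!: arg_cong2[where f = measure] simp: space_PiM)
    also have "\<dots> = (\<Prod>t\<in>UNIV. prob (B t))"
    proof -
      interpret product_sigma_finite "\<lambda>t::'t. \<nu>"
        by unfold_locales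
      have "emeasure (\<Pi>\<^sub>M t\<in>(UNIV :: 't set). \<nu>) (Pi\<^sub>E UNIV B) = ennreal (\<Prod>t\<in>UNIV. prob (B t))"
        by (simp add: emeasure_PiM emeasure_eq_measure prod_ennreal)
      then show ?thesis
        by (simp add: P.emeasure_eq_measure prod_nonneg)
    qed
    also have "\<dots> = (\<Prod>t\<in>UNIV. joint_cdf \<nu> (w t * x))"
    proof (rule prod.cong[OF refl])
      fix t
      show "prob (B t) = joint_cdf \<nu> (w t * x)"
        unfolding joint_cdf_eq
      proof (rule measure_eq_AE)
        show "AE z in \<nu>. z \<in> B t \<longleftrightarrow> z \<in> {z. \<forall>i. z $ i \<le> (w t * x) $ i}"
          using AE_nonpos
        proof eventually_elim
          case (elim z)
          have "z $ i \<le> w t $ i * x $ i" if "z \<in> B t" for i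
            using that elim w[of t i] by (cases "w t $ i = 0") (auto simp: B_def)
          then show ?case by (auto simp: B_def)
        qed
      qed (use B in \<open>auto simp: sets_eq\<close>)
    qed
    finally show ?thesis .
  qed
  interpret N: prob_space \<nu>' using jd by (simp add: joint_distribution_def)
  have [measurable_cong]: "sets \<nu>' = sets borel" by (simp add: \<nu>'_def)
  have [simp]: "space \<nu>' = UNIV" by (simp add: \<nu>'_def)
  have nonpos: "AE z in \<nu>'. z \<le> 0"
  proof -
    have "AE z in \<nu>'. z \<in> {..0}"
      using cdf[of 0] by (intro N.AE_prob_1) (simp add: joint_cdf_def[symmetric])
    then show ?thesis by simp
  qed
  have margin: "cdf (margin \<nu>' i) s = exp s" if "s \<le> 0" for i s
  proof -
    \<comment> \<open>The bound 0 in the coordinates other than \<open>i\<close> costs nothing, as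
      the law lives on nonpositive vectors.\<close>
    have "cdf (margin \<nu>' i) s = joint_cdf \<nu>' (axis i s)"
      unfolding cdf_margin[OF jd] joint_cdf_def
    proof (rule measure_eq_AE)
      show "AE z in \<nu>'. z \<in> {z. z $ i \<le> s} \<longleftrightarrow> z \<in> {..axis i s}"
        using nonpos by eventually_elim (use that in \<open>auto simp: less_eq_vec_def axis_def\<close>)
    qed auto
    also have "\<dots> = (\<Prod>t\<in>UNIV. exp (w t $ i * s))"
      unfolding cdf
    proof (rule prod.cong[OF refl])
      fix t
      show "joint_cdf \<nu> (w t * axis i s) = exp (w t $ i * s)"
        using that w[of t i] by (subst joint_cdf_single[of i]) (simp_all add: axis_def min_absorb2 mult_nonneg_nonpos)
    qed
    also have "\<dots> = exp s"
      by (simp add: exp_sum[symmetric] sum_distrib_right[symmetric] sum_w)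
    finally show ?thesis .
  qed
  have "neg_exp_evd \<nu>'"
  proof
    show "standard_neg_exp_margins \<nu>'"
      using margin by (simp add: standard_neg_exp_margins_def)
    have "margin \<nu>' i \<noteq> return borel a" for i a
    proof
      assume "margin \<nu>' i = return borel a"
      \<comment> \<open>A point mass has a distribution function with values 0 and 1 only, unlike
        \<open>exp (-1)\<close>.\<close>
      then have "cdf (margin \<nu>' i) (-1) \<in> {0, 1}"
        by (auto simp: cdf_def measure_return indicator_def)
      then show False using margin[of "-1" i] by simp
    qed
    moreover have "max_stable (joint_cdf \<nu>')"
      unfolding max_stable_def
    proof (intro allI impI)
      fix n :: nat assume n: "n \<ge> 1"
      have "joint_cdf \<nu>' ((\<chi> i. 1 / real n) * x + 0) ^ n = joint_cdf \<nu>' x" for x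
      proof -
        have "w t * ((\<chi> i. 1 / real n) * x) = (w t * x) /\<^sub>R real n" for t
          by (auto simp: vec_eq_iff divide_inverse)
        then show ?thesis
          by (simp only: cdf add_0_right prod_power_distrib joint_cdf_scale[OF n])
      qed
      then show "\<exists>c d. (\<forall>i. c $ i > 0) \<and> (\<forall>x. joint_cdf \<nu>' (c * x + d) ^ n = joint_cdf \<nu>' x)"
        using n by (intro exI[of _ "\<chi> i. 1 / real n"] exI[of _ 0]) auto
    qed
    ultimately show "extreme_value_distribution \<nu>'"
      using jd by (auto simp: extreme_value_distribution_def)
  qed
  then show ?thesis using cdf that by blast
qed

section \<open>Laws of random vectors, copulas and scaling of the Pickands form\<close>

lemma (in prob_space) joint_distribution_distr:
  "random_variable borel X \<Longrightarrow> joint_distribution (distr M borel X)"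
  by (simp add: joint_distribution_def prob_space_distr)

lemma (in prob_space) joint_cdf_distr:
  fixes X :: "'a \<Rightarrow> real ^ 'm"
  assumes "random_variable borel X"
  shows "joint_cdf (distr M borel X) x = prob {\<omega> \<in> space M. X \<omega> \<le> x}"
  using assms by (simp add: joint_cdf_def measure_distr vimage_def Int_def conj_commute)

lemma (in prob_space) margin_distr:
  fixes X :: "'a \<Rightarrow> real ^ 'm"
  assumes [measurable]: "random_variable borel X"
  shows "margin (distr M borel X) i = distr M borel (\<lambda>\<omega>. X \<omega> $ i)"
  unfolding margin_def by (subst distr_distr) (auto simp: comp_def)

text \<open>The measure witnessing \<open>copula\<close> must be the law of \<open>X\<close>, since
  both have the same distribution function; its margins are therefore those of
  \<open>X\<close>.\<close>

lemma (in prob_space) copula_iff_margins: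
  fixes X :: "'a \<Rightarrow> real ^ 'm"
  assumes X: "random_variable borel X"
  shows "copula (\<lambda>x. prob {\<omega> \<in> space M. X \<omega> \<le> x}) \<longleftrightarrow>
    (\<forall>i. distr M borel (\<lambda>\<omega>. X \<omega> $ i) = uniform_measure lborel {-1..0})"
proof
  assume "copula (\<lambda>x. prob {\<omega> \<in> space M. X \<omega> \<le> x})"
  then obtain \<mu> where \<mu>: "joint_distribution \<mu>" "\<And>x. prob {\<omega> \<in> space M. X \<omega> \<le> x} = joint_cdf \<mu> x"
      "\<And>i. margin \<mu> i = uniform_measure lborel {-1..0}"
    unfolding copula_def by metis
  have "distr M borel X = \<mu>"
    using \<mu> by (intro joint_distribution_eqI joint_distribution_distr X) (simp_all add: joint_cdf_distr X)
  then show "\<forall>i. distr M borel (\<lambda>\<omega>. X \<omega> $ i) = uniform_measure lborel {-1..0}"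
    using \<mu>(3) margin_distr[OF X] by metis
next
  assume "\<forall>i. distr M borel (\<lambda>\<omega>. X \<omega> $ i) = uniform_measure lborel {-1..0}"
  then show "copula (\<lambda>x. prob {\<omega> \<in> space M. X \<omega> \<le> x})"
    unfolding copula_def using X
    by (intro exI[of _ "distr M borel X"])
       (simp add: fun_eq_iff joint_distribution_distr joint_cdf_distr margin_distr)
qed

text \<open>The argument of \<open>D\<close> is invariant under scaling by a nonzero factor, and
  only the sum in front scales; for \<open>c = 0\<close> both sides vanish.\<close>

lemma gpd_form_scaleR:
  "gpd_form l D (c *\<^sub>R x) - 1 = c * (gpd_form l D x - 1)"
  by (cases "c = 0") (simp_all add: gpd_form_def Let_def sum_distrib_left[symmetric])

text \<open>Since 0 is the upper end of the support of a copula on \<open>[-1,0]\<close>, zeroing a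
  coordinate of an upper bound drops its constraint. Marginal probabilities thus become values of
  the joint distribution function.\<close>

definition restrict_vec :: "'m set \<Rightarrow> real ^ 'm \<Rightarrow> real ^ 'm" where
  "restrict_vec T x = (\<chi> i. if i \<in> T then x $ i else 0)"

lemma restrict_vec_nth [simp]: "restrict_vec T x $ i = (if i \<in> T then x $ i else 0)"
  by (simp add: restrict_vec_def)

lemma restrict_vec_scaleR: "restrict_vec T (c *\<^sub>R x) = c *\<^sub>R restrict_vec T x"
  by (simp add: vec_eq_iff)

subsection \<open>Homogeneity of survival probabilities near 0\<close>

locale copula_variable = prob_space M for M :: "'a measure" +
  fixes V :: "'a \<Rightarrow> real ^ 'm"
  assumes measurable_V [measurable]: "V \<in> borel_measurable M"
    and distr_V: "\<And>i. distr M borel (\<lambda>\<omega>. V \<omega> $ i) = uniform_measure lborel {-1..0}"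
begin

lemma measurable_V_nth [measurable]: "(\<lambda>\<omega>. V \<omega> $ i) \<in> borel_measurable M"
  using measurable_compose[OF measurable_V borel_measurable_vec_nth] .

lemma uniform_nth: "uniform_Icc_variable M (\<lambda>\<omega>. V \<omega> $ i)"
  by unfold_locales (auto simp: distr_V)

lemma AE_in_box: "AE \<omega> in M. \<forall>i. -1 < V \<omega> $ i \<and> V \<omega> $ i \<le> 0"
  using uniform_Icc_variable.AE_in_Ioo[OF uniform_nth] by (simp add: AE_all_countable)

lemma AE_neq_nth: "AE \<omega> in M. \<forall>i. V \<omega> $ i \<noteq> x $ i"
  using uniform_Icc_variable.AE_neq[OF uniform_nth] by (simp add: AE_all_countable)

lemma prob_le_restrict_vec:
  "prob {\<omega> \<in> space M. \<forall>i\<in>T. V \<omega> $ i \<le> x $ i} = prob {\<omega> \<in> space M. V \<omega> \<le> restrict_vec T x}"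
proof (rule finite_measure_eq_AE)
  show "AE \<omega> in M. \<omega> \<in> {\<omega> \<in> space M. \<forall>i\<in>T. V \<omega> $ i \<le> x $ i} \<longleftrightarrow>
      \<omega> \<in> {\<omega> \<in> space M. V \<omega> \<le> restrict_vec T x}"
    using AE_in_box by eventually_elim (auto simp: less_eq_vec_def)
qed (auto simp: less_eq_vec_def)

context
  fixes l :: 'm and D :: "('m \<Rightarrow> real) \<Rightarrow> real" and x0 :: "real ^ 'm"
  assumes x0: "\<And>i. x0 $ i \<le> 0"
    and pickands: "\<And>x. x \<in> {x0..0} \<Longrightarrow> prob {\<omega> \<in> space M. V \<omega> \<le> x} = gpd_form l D x"
begin

lemma prob_le_pickands:
  assumes "x \<in> {x0..0}"
  shows "prob {\<omega> \<in> space M. \<forall>i\<in>T. V \<omega> $ i \<le> x $ i} = gpd_form l D (restrict_vec T x)"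
  unfolding prob_le_restrict_vec using assms x0
  by (intro pickands) (auto simp: less_eq_vec_def)

text \<open>Each split of one constraint \<open>x $ k < V $ k\<close> expresses the probability as a difference
  of two lower orthant probabilities, in which the constant 1 of the Pickands form cancels.\<close>

lemma prob_greater_scaleR:
  assumes K: "K \<noteq> {}" and x: "x \<in> {x0..0}" and q: "0 \<le> q" "q \<le> 1"
  shows "prob {\<omega> \<in> space M. (\<forall>i\<in>K. q * x $ i < V \<omega> $ i) \<and> (\<forall>i\<in>T. V \<omega> $ i \<le> q * x $ i)} =
    q * prob {\<omega> \<in> space M. (\<forall>i\<in>K. x $ i < V \<omega> $ i) \<and> (\<forall>i\<in>T. V \<omega> $ i \<le> x $ i)}"
proof -
  define f where "f K T z = prob {\<omega> \<in> space M. (\<forall>i\<in>K. z $ i < V \<omega> $ i) \<and> (\<forall>i\<in>T. V \<omega> $ i \<le> z $ i)}"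
    for K T and z :: "real ^ 'm"
  have split: "f (insert k K) T z = f K T z - f K (insert k T) z" for k K T z
  proof -
    have "f K T z = f (insert k K) T z + f K (insert k T) z"
      unfolding f_def by (subst finite_measure_Union[symmetric]) (auto intro!: arg_cong[where f = prob])
    then show ?thesis by simp
  qed
  have qx: "q *\<^sub>R x \<in> {x0..0}"
  proof -
    have "x0 $ i \<le> q * x $ i \<and> q * x $ i \<le> 0" for i
    proof -
      have "x0 $ i \<le> x $ i" "x $ i \<le> 0" using x by (auto simp: less_eq_vec_def)
      moreover have "x $ i \<le> q * x $ i"
        using q mult_right_mono_neg[OF q(2) \<open>x $ i \<le> 0\<close>] by simp
      ultimately show ?thesis using q by (auto simp: mult_nonneg_nonpos)
    qed
    then show ?thesis by (auto simp: less_eq_vec_def)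
  qed
  \<comment> \<open>Without strict constraints only the deviation from 1 is homogeneous, so the
    induction has to start at singletons.\<close>
  have empty: "f {} T (q *\<^sub>R x) - 1 = q * (f {} T x - 1)" for T
    using prob_le_pickands[OF x, of T] prob_le_pickands[OF qx, of T]
    by (simp add: f_def restrict_vec_scaleR gpd_form_scaleR)
  \<comment> \<open>\<open>T\<close> varies in the induction because \<open>split\<close> moves
    \<open>k\<close> into the set of weak constraints.\<close>
  have "f K T (q *\<^sub>R x) = q * f K T x"
    using finite[of K] K
  proof (induction K arbitrary: T rule: finite_ne_induct)
    case (singleton k)
    show ?case
      using empty[of T] empty[of "insert k T"] by (simp add: split algebra_simps)
  next
    case (insert k K)
    then show ?case by (simp add: split algebra_simps)
  qed
  then show ?thesis by (simp add: f_def)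
qed

lemma prob_ge_scaleR:
  assumes K: "K \<noteq> {}" and x: "\<And>i. i \<in> K \<Longrightarrow> x $ i \<in> {x0 $ i..0}" and q: "0 \<le> q" "q \<le> 1"
  shows "prob {\<omega> \<in> space M. \<forall>i\<in>K. q * x $ i \<le> V \<omega> $ i} =
    q * prob {\<omega> \<in> space M. \<forall>i\<in>K. x $ i \<le> V \<omega> $ i}"
proof -
  have strict: "prob {\<omega> \<in> space M. \<forall>i\<in>K. z $ i \<le> V \<omega> $ i} =
      prob {\<omega> \<in> space M. \<forall>i\<in>K. z $ i < V \<omega> $ i}" for z
  proof (rule finite_measure_eq_AE)
    show "AE \<omega> in M. \<omega> \<in> {\<omega> \<in> space M. \<forall>i\<in>K. z $ i \<le> V \<omega> $ i} \<longleftrightarrow>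
        \<omega> \<in> {\<omega> \<in> space M. \<forall>i\<in>K. z $ i < V \<omega> $ i}"
      using AE_neq_nth[of z] by eventually_elim (auto simp: order_less_le dest: sym)
  qed auto
  \<comment> \<open>Only the coordinates in \<open>K\<close> are known to lie in the box; zeroing
    the others does not change the event.\<close>
  have "restrict_vec K x \<in> {x0..0}"
    using x x0 by (auto simp: less_eq_vec_def)
  from prob_greater_scaleR[OF K this q, of "{}"] show ?thesis
    using strict[of x] strict[of "q *\<^sub>R x"] by (simp cong: ball_cong)
qed

end

end

lemma (in prob_space) prob_indep_var:
  assumes "indep_var borel X borel Y" "A \<in> sets borel" "B \<in> sets borel"
  shows "prob {\<omega> \<in> space M. X \<omega> \<in> A \<and> Y \<omega> \<in> B} =
    prob {\<omega> \<in> space M. X \<omega> \<in> A} * prob {\<omega> \<in> space M. Y \<omega> \<in> B}"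
  using indep_varD[OF assms] by (simp add: vimage_def Int_def conj_commute)

subsection \<open>Replacing the upper part of a copula\<close>

locale copula_splice = prob_space M + V: copula_variable M V + Y: copula_variable M Y
  for M :: "'a measure" and V Y :: "'a \<Rightarrow> real ^ 'm" +
  fixes y :: "real ^ 'm"
  assumes indep: "indep_var borel Y borel V"
    and y_bounds: "\<And>i. y $ i \<in> {-1..0}"
    and exceed_pos: "prob {\<omega> \<in> space M. \<forall>i. Y \<omega> $ i > y $ i} > 0"
begin

text \<open>The factor \<open>- y $ i\<close> compresses \<open>[-1,0]\<close> onto
  \<open>[y $ i, 0]\<close>, so that \<open>V\<close> replaces the part of \<open>Y\<close> above
  the threshold.\<close>

definition Q :: "'a \<Rightarrow> real ^ 'm" where
  "Q \<omega> = (\<chi> i. if Y \<omega> $ i \<le> y $ i then Y \<omega> $ i else - y $ i * V \<omega> $ i)"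

definition exceed_set :: "'a \<Rightarrow> 'm set" where
  "exceed_set \<omega> = {i. Y \<omega> $ i > y $ i}"

definition p :: "'m set \<Rightarrow> real" where
  "p T = prob {\<omega> \<in> space M. exceed_set \<omega> = T}"

lemma prob_exceed: "prob {\<omega> \<in> space M. Y \<omega> $ i > y $ i} = - y $ i"
  using uniform_Icc_variable.prob_greater[OF Y.uniform_nth[of i], of "y $ i"] y_bounds[of i]
  by (simp add: min_def max_def split: if_splits)

lemma prob_exceed_mono:
  "K \<subseteq> L \<Longrightarrow> prob {\<omega> \<in> space M. \<forall>j\<in>L. Y \<omega> $ j > y $ j} \<le> prob {\<omega> \<in> space M. \<forall>j\<in>K. Y \<omega> $ j > y $ j}"
  by (intro finite_measure_mono) auto

lemma prob_exceed_pos: "prob {\<omega> \<in> space M. \<forall>j\<in>K. Y \<omega> $ j > y $ j} > 0"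
  using prob_exceed_mono[of K UNIV] exceed_pos by simp

text \<open>The exceedance probability of coordinate \<open>i\<close> is \<open>- y $ i\<close> and
  is positive, which legitimates every division by \<open>- y $ i\<close>.\<close>

lemma y_neg: "y $ i < 0"
  using prob_exceed_pos[of "{i}"] by (simp add: prob_exceed)

lemma measurable_Q_nth [measurable]: "(\<lambda>\<omega>. Q \<omega> $ i) \<in> borel_measurable M"
  unfolding Q_def by simp

lemma measurable_Q [measurable]: "Q \<in> borel_measurable M"
  by (rule borel_measurable_vecI) simp

text \<open>This coordinatewise form shows the event to be a Borel condition on \<open>Y\<close>, as
  measurability and the product rule for independence require.\<close>

lemma exceed_set_eq:
  "exceed_set \<omega> = T \<longleftrightarrow> (\<forall>i. if i \<in> T then Y \<omega> $ i > y $ i else \<not> Y \<omega> $ i > y $ i)"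
  by (auto simp: exceed_set_def split: if_splits)

lemma measurable_exceed_set [measurable]: "Measurable.pred M (\<lambda>\<omega>. exceed_set \<omega> = T)"
  unfolding exceed_set_eq by measurable

text \<open>A coordinate that does not exceed its threshold satisfies the bound automatically,
  because \<open>Y \<omega> $ i \<le> y $ i \<le> t\<close>.\<close>

lemma Q_le_iff:
  assumes "y $ i \<le> t"
  shows "Q \<omega> $ i \<le> t \<longleftrightarrow> (i \<in> exceed_set \<omega> \<longrightarrow> V \<omega> $ i \<le> t / - y $ i)"
  using assms y_neg[of i] by (auto simp: Q_def exceed_set_def field_simps)

text \<open>Partition by the exceedance set. A singleton \<open>K\<close> serves the margins, and
  \<open>K = UNIV\<close> the joint distribution function.\<close>

lemma prob_Q_le_upper:
  assumes x: "\<And>i. i \<in> K \<Longrightarrow> y $ i \<le> x $ i"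
  shows "prob {\<omega> \<in> space M. \<forall>i\<in>K. Q \<omega> $ i \<le> x $ i} =
    (\<Sum>T\<in>UNIV. p T * prob {\<omega> \<in> space M. \<forall>i\<in>K \<inter> T. V \<omega> $ i \<le> x $ i / - y $ i})"
proof -
  have "prob {\<omega> \<in> space M. \<forall>i\<in>K. Q \<omega> $ i \<le> x $ i} =
      prob (\<Union>T\<in>UNIV. {\<omega> \<in> space M. exceed_set \<omega> = T \<and> (\<forall>i\<in>K \<inter> T. V \<omega> $ i \<le> x $ i / - y $ i)})"
    using Q_le_iff[OF x] by (intro arg_cong[where f = prob]) auto
  also have "\<dots> = (\<Sum>T\<in>UNIV. prob {\<omega> \<in> space M. exceed_set \<omega> = T \<and> (\<forall>i\<in>K \<inter> T. V \<omega> $ i \<le> x $ i / - y $ i)})"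
    by (rule finite_measure_finite_Union) (auto simp: disjoint_family_on_def)
  also have "\<dots> = (\<Sum>T\<in>UNIV. p T * prob {\<omega> \<in> space M. \<forall>i\<in>K \<inter> T. V \<omega> $ i \<le> x $ i / - y $ i})"
  proof (rule sum.cong[OF refl])
    fix T
    have "{z. \<forall>i. if i \<in> T then z $ i > y $ i else \<not> z $ i > y $ i} \<in> sets borel"
      "{z. \<forall>i\<in>K \<inter> T. z $ i \<le> x $ i / - y $ i} \<in> sets borel"
      by measurable
    from prob_indep_var[OF indep this]
    show "prob {\<omega> \<in> space M. exceed_set \<omega> = T \<and> (\<forall>i\<in>K \<inter> T. V \<omega> $ i \<le> x $ i / - y $ i)} =
        p T * prob {\<omega> \<in> space M. \<forall>i\<in>K \<inter> T. V \<omega> $ i \<le> x $ i / - y $ i}"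
      by (simp add: exceed_set_eq p_def)
  qed
  finally show ?thesis .
qed

text \<open>Up to a null set, a coordinate without exceedance has
  \<open>Q \<omega> $ i < y $ i \<le> x $ i\<close>; hence all of \<open>K\<close> must exceed and a
  single product remains.\<close>

lemma prob_Q_ge:
  assumes x: "\<And>i. i \<in> K \<Longrightarrow> y $ i \<le> x $ i"
  shows "prob {\<omega> \<in> space M. \<forall>i\<in>K. x $ i \<le> Q \<omega> $ i} =
    prob {\<omega> \<in> space M. \<forall>i\<in>K. Y \<omega> $ i > y $ i} * prob {\<omega> \<in> space M. \<forall>i\<in>K. x $ i / - y $ i \<le> V \<omega> $ i}"
proof -
  have "prob {\<omega> \<in> space M. \<forall>i\<in>K. x $ i \<le> Q \<omega> $ i} =
      prob {\<omega> \<in> space M. (\<forall>i\<in>K. Y \<omega> $ i > y $ i) \<and> (\<forall>i\<in>K. x $ i / - y $ i \<le> V \<omega> $ i)}"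
  proof (rule finite_measure_eq_AE)
    show "AE \<omega> in M. \<omega> \<in> {\<omega> \<in> space M. \<forall>i\<in>K. x $ i \<le> Q \<omega> $ i} \<longleftrightarrow>
        \<omega> \<in> {\<omega> \<in> space M. (\<forall>i\<in>K. Y \<omega> $ i > y $ i) \<and> (\<forall>i\<in>K. x $ i / - y $ i \<le> V \<omega> $ i)}"
      using Y.AE_neq_nth[of y]
    proof eventually_elim
      case (elim \<omega>)
      have "x $ i \<le> Q \<omega> $ i \<longleftrightarrow> Y \<omega> $ i > y $ i \<and> x $ i / - y $ i \<le> V \<omega> $ i" if "i \<in> K" for i
      proof (cases "Y \<omega> $ i > y $ i")
        case True
        then show ?thesis using y_neg[of i] by (auto simp: Q_def field_simps)
      next
        case False
        then have "Y \<omega> $ i < y $ i" using elim by (metis linorder_cases)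
        then show ?thesis using x[OF that] by (simp add: Q_def)
      qed
      then show ?case by auto
    qed
  qed auto
  also have "\<dots> = prob {\<omega> \<in> space M. \<forall>i\<in>K. Y \<omega> $ i > y $ i} * prob {\<omega> \<in> space M. \<forall>i\<in>K. x $ i / - y $ i \<le> V \<omega> $ i}"
  proof -
    have "{z. \<forall>i\<in>K. z $ i > y $ i} \<in> sets borel" "{z. \<forall>i\<in>K. x $ i / - y $ i \<le> z $ i} \<in> sets borel"
      by measurable
    from prob_indep_var[OF indep this] show ?thesis by simp
  qed
  finally show ?thesis .
qed

text \<open>On exceedance, \<open>Q \<omega> $ i\<close> and \<open>Y \<omega> $ i\<close> both lie
  above \<open>y $ i\<close> almost surely, so both inequalities fail; otherwise the two values
  coincide.\<close>

lemma prob_Q_le_lower: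
  assumes x: "\<And>i. i \<in> K \<Longrightarrow> x $ i \<le> y $ i"
  shows "prob {\<omega> \<in> space M. \<forall>i\<in>K. Q \<omega> $ i \<le> x $ i} = prob {\<omega> \<in> space M. \<forall>i\<in>K. Y \<omega> $ i \<le> x $ i}"
proof (rule finite_measure_eq_AE)
  show "AE \<omega> in M. \<omega> \<in> {\<omega> \<in> space M. \<forall>i\<in>K. Q \<omega> $ i \<le> x $ i} \<longleftrightarrow>
      \<omega> \<in> {\<omega> \<in> space M. \<forall>i\<in>K. Y \<omega> $ i \<le> x $ i}"
    using V.AE_in_box
  proof eventually_elim
    case (elim \<omega>)
    have "Q \<omega> $ i \<le> x $ i \<longleftrightarrow> Y \<omega> $ i \<le> x $ i" if "i \<in> K" for i
    proof (cases "Y \<omega> $ i > y $ i")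
      case True
      have "- y $ i * -1 < - y $ i * V \<omega> $ i"
        using elim y_neg[of i] by (intro mult_strict_left_mono) auto
      then show ?thesis using x[OF that] True by (auto simp: Q_def)
    qed (simp add: Q_def)
    then show ?case by auto
  qed
qed auto

text \<open>This is the normalization behind both the uniform margins of \<open>Q\<close> and the
  weights of the new extreme value distribution.\<close>

lemma sum_p_exceed: "(\<Sum>T\<in>UNIV. if i \<in> T then p T else 0) = - y $ i"
proof -
  have "- y $ i = prob (\<Union>T\<in>{T. i \<in> T}. {\<omega> \<in> space M. exceed_set \<omega> = T})"
    unfolding prob_exceed[of i, symmetric] by (intro arg_cong[where f = prob]) (auto simp: exceed_set_def)
  also have "\<dots> = (\<Sum>T\<in>{T. i \<in> T}. p T)"
    unfolding p_def by (rule finite_measure_finite_Union) (auto simp: disjoint_family_on_def)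
  finally show ?thesis by (simp add: sum.If_cases)
qed

lemma sum_p: "(\<Sum>T\<in>UNIV. p T) = 1"
proof -
  have "1 = prob (\<Union>T\<in>UNIV. {\<omega> \<in> space M. exceed_set \<omega> = T})"
    unfolding prob_space[symmetric] by (intro arg_cong[where f = prob]) auto
  also have "\<dots> = (\<Sum>T\<in>UNIV. p T)"
    unfolding p_def by (rule finite_measure_finite_Union) (auto simp: disjoint_family_on_def)
  finally show ?thesis by simp
qed

lemma p_nonneg: "p T \<ge> 0" and p_le_1: "p T \<le> 1"
  by (simp_all add: p_def)

text \<open>Up to \<open>y $ i\<close> the distribution function is that of \<open>Y\<close>; beyond
  it, each \<open>T\<close> containing \<open>i\<close> contributes slope
  \<open>p T / - y $ i\<close>, and these slopes add up to 1.\<close>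

lemma distr_Q: "distr M borel (\<lambda>\<omega>. Q \<omega> $ i) = uniform_measure lborel {-1..0}"
proof (rule distr_eq_uniform_measure_IccI)
  fix t :: real
  assume t: "t \<in> {-1..0}"
  show "prob {\<omega> \<in> space M. Q \<omega> $ i \<le> t} = 1 + t"
  proof (cases "t \<le> y $ i")
    case True
    then have "prob {\<omega> \<in> space M. Q \<omega> $ i \<le> t} = prob {\<omega> \<in> space M. Y \<omega> $ i \<le> t}"
      using prob_Q_le_lower[of "{i}" "\<chi> _. t"] by simp
    then show ?thesis
      using t uniform_Icc_variable.prob_le[OF Y.uniform_nth, of i t] by simp
  next
    case False
    have i_T: "prob {\<omega> \<in> space M. \<forall>j\<in>{i} \<inter> T. V \<omega> $ j \<le> (\<chi> _. t) $ j / - y $ j} =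
        1 + (if i \<in> T then t / - y $ i else 0)" for T
    proof (cases "i \<in> T")
      case True
      have "-1 \<le> t / - y $ i" "t / - y $ i \<le> 0"
        using False t y_neg[of i] by (auto simp: field_simps)
      then show ?thesis
        using True uniform_Icc_variable.prob_le[OF V.uniform_nth, of i "t / - y $ i"] by simp
    qed (simp add: prob_space)
    have "prob {\<omega> \<in> space M. Q \<omega> $ i \<le> t} =
        (\<Sum>T\<in>UNIV. p T * (1 + (if i \<in> T then t / - y $ i else 0)))"
      using False prob_Q_le_upper[of "{i}" "\<chi> _. t"] by (simp only: i_T) simp
    also have "\<dots> = (\<Sum>T\<in>UNIV. p T + t / - y $ i * (if i \<in> T then p T else 0))"
      by (intro sum.cong) (simp_all add: algebra_simps)
    also have "\<dots> = 1 + t / - y $ i * - y $ i"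
      by (simp only: sum.distrib sum_p sum_p_exceed flip: sum_distrib_left)
    finally show ?thesis using y_neg[of i] by simp
  qed
qed simp

lemma gpd_copula_Q:
  assumes gpd: "gpd_copula (\<lambda>x. prob {\<omega> \<in> space M. V \<omega> \<le> x})"
    and x0: "\<And>i. x0 $ i < 0"
    and pickands: "\<And>x. x \<in> {x0..0} \<Longrightarrow> prob {\<omega> \<in> space M. V \<omega> \<le> x} = gpd_form l D x"
  shows "gpd_copula (\<lambda>x. prob {\<omega> \<in> space M. Q \<omega> \<le> x})"
proof -
  obtain z0 \<nu> where z0: "\<And>i. z0 $ i < 0"
    and "extreme_value_distribution \<nu>" "standard_neg_exp_margins \<nu>"
    and V_ln: "\<And>x. x \<in> {z0..0} \<Longrightarrow> prob {\<omega> \<in> space M. V \<omega> \<le> x} = 1 + ln (joint_cdf \<nu> x)"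
    using gpd unfolding gpd_copula_def by metis
  interpret G: neg_exp_evd \<nu> by unfold_locales fact+
  \<comment> \<open>The weights combine the rescaling of \<open>V\<close> by \<open>- y $ i\<close>
    with the factor \<open>p T\<close> that homogeneity moves into the argument of the
    logarithm.\<close>
  define w where "w T = (\<chi> i. if i \<in> T then p T / - y $ i else 0)" for T
  have w_nonneg: "w T $ i \<ge> 0" for T i
    using p_nonneg[of T] y_neg[of i] by (simp add: w_def divide_le_0_iff)
  have sum_w: "(\<Sum>T\<in>UNIV. w T $ i) = 1" for i
  proof -
    have "(\<Sum>T\<in>UNIV. w T $ i) = (\<Sum>T\<in>UNIV. (if i \<in> T then p T else 0) / - y $ i)"
      by (intro sum.cong) (simp_all add: w_def)
    also have "\<dots> = 1"
      using y_neg[of i] by (simp only: sum_p_exceed flip: sum_divide_distrib) simp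
    finally show ?thesis .
  qed
  obtain \<nu>' where \<nu>': "neg_exp_evd \<nu>'"
    and cdf: "\<And>x. joint_cdf \<nu>' x = (\<Prod>T\<in>UNIV. joint_cdf \<nu> (w T * x))"
    using exists_neg_exp_evd_prod[OF G.neg_exp_evd_axioms w_nonneg sum_w] by blast
  interpret G': neg_exp_evd \<nu>' by fact
  \<comment> \<open>Above \<open>r\<close> both representations of the law of \<open>V\<close> are
    valid, and the third bound stays strictly above \<open>- 1 / CARD('m)\<close>, as
    \<open>joint_cdf_pos\<close> demands.\<close>
  define r where "r i = max (max (x0 $ i) (z0 $ i)) (- 1 / (2 * CARD('m)))" for i
  \<comment> \<open>The first bound is for the splitting formula; the second keeps
    \<open>x $ i / - y $ i\<close> above \<open>r i\<close>.\<close>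
  define x1 where "x1 = (\<chi> i. max (y $ i) (- y $ i * r i))"
  have r: "r i < 0" for i using x0[of i] z0[of i] by (simp add: r_def)
  have near_0: "prob {\<omega> \<in> space M. Q \<omega> \<le> x} = 1 + ln (joint_cdf \<nu>' x)" if x: "x \<in> {x1..0}" for x
  proof -
    define v where "v T = (\<chi> i. if i \<in> T then x $ i / - y $ i else 0)" for T
    have v_bounds: "r i \<le> c * v T $ i \<and> c * v T $ i \<le> 0" if c: "0 \<le> c" "c \<le> 1" for c T i
    proof -
      have "- y $ i * r i \<le> x $ i" "x $ i \<le> 0"
        using x by (auto simp: less_eq_vec_def x1_def)
      then have "r i \<le> v T $ i" "v T $ i \<le> 0"
        using y_neg[of i] r[of i] by (auto simp: v_def field_simps)
      moreover have "v T $ i \<le> c * v T $ i"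
        using mult_right_mono_neg[OF c(2) \<open>v T $ i \<le> 0\<close>] by simp
      ultimately show ?thesis using c by (auto simp: mult_nonneg_nonpos)
    qed
    have v: "c *\<^sub>R v T \<in> {x0..0}" "c *\<^sub>R v T \<in> {z0..0}" "joint_cdf \<nu> (c *\<^sub>R v T) > 0"
      if c: "0 \<le> c" "c \<le> 1" for c T
    proof -
      show "c *\<^sub>R v T \<in> {x0..0}" "c *\<^sub>R v T \<in> {z0..0}"
        using v_bounds[OF c] by (auto simp: less_eq_vec_def r_def)
      have "- 1 / real CARD('m) < - 1 / (2 * real CARD('m))" by (simp add: field_simps)
      also have "\<dots> \<le> r i" for i by (simp add: r_def)
      finally have "- 1 / real CARD('m) < r i" for i .
      then show "joint_cdf \<nu> (c *\<^sub>R v T) > 0"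
        using v_bounds[OF c] by (intro G.joint_cdf_pos) (auto intro: less_le_trans)
    qed
    \<comment> \<open>Near 0 the logarithm equals the Pickands form minus 1, and so inherits its
      homogeneity.\<close>
    have ln_scale: "ln (joint_cdf \<nu> (c *\<^sub>R v T)) = c * ln (joint_cdf \<nu> (v T))"
      if c: "0 \<le> c" "c \<le> 1" for c T
      using gpd_form_scaleR[of l D c "v T"] v(1,2)[OF c, of T] v(1,2)[of 1 T]
      by (simp add: V_ln flip: pickands)
    have w_v: "w T * x = p T *\<^sub>R v T" for T
      by (simp add: vec_eq_iff w_def v_def)
    have "prob {\<omega> \<in> space M. Q \<omega> \<le> x} =
        (\<Sum>T\<in>UNIV. p T * prob {\<omega> \<in> space M. \<forall>i\<in>T. V \<omega> $ i \<le> v T $ i})"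
      using prob_Q_le_upper[of UNIV x] x by (simp add: less_eq_vec_def x1_def v_def)
    also have "\<dots> = (\<Sum>T\<in>UNIV. p T + ln (joint_cdf \<nu> (w T * x)))"
    proof (rule sum.cong[OF refl])
      fix T
      have "restrict_vec T (v T) = v T" by (simp add: vec_eq_iff v_def)
      then have "prob {\<omega> \<in> space M. \<forall>i\<in>T. V \<omega> $ i \<le> v T $ i} = 1 + ln (joint_cdf \<nu> (v T))"
        using V_ln v(2)[of 1 T] by (simp add: V.prob_le_restrict_vec)
      then show "p T * prob {\<omega> \<in> space M. \<forall>i\<in>T. V \<omega> $ i \<le> v T $ i} = p T + ln (joint_cdf \<nu> (w T * x))"
        by (simp add: w_v ln_scale p_nonneg p_le_1 distrib_left)
    qed
    also have "\<dots> = 1 + ln (\<Prod>T\<in>UNIV. joint_cdf \<nu> (w T * x))"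
      using v(3)[OF p_nonneg p_le_1] by (subst ln_prod) (auto simp: w_v sum.distrib sum_p less_imp_neq[symmetric])
    finally show ?thesis by (simp add: cdf)
  qed
  show ?thesis
    unfolding gpd_copula_def
  proof (intro conjI exI[of _ x1] exI[of _ \<nu>'] allI ballI)
    show "copula (\<lambda>x. prob {\<omega> \<in> space M. Q \<omega> \<le> x})"
      by (simp add: copula_iff_margins distr_Q)
    show "x1 $ i < 0" for i
      using y_neg[of i] r[of i] by (simp add: x1_def mult_neg_neg zero_less_mult_iff)
  qed (use near_0 G'.evd G'.margins in auto)
qed

end

text \<open>The survival formula also asks for \<open>x0 $ i \<le> x $ i / - y $ i\<close> on
  \<open>K\<close>: the proof evaluates the Pickands form at these quotients, and dividing by
  \<open>- y $ i \<le> 1\<close> can carry a point out of the box.\<close>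

theorem proposition3p1:
  fixes M :: "'a measure"
    and V Y Q :: "'a \<Rightarrow> real ^ 'm"
    and C :: "real ^ 'm \<Rightarrow> real"
    and D :: "('m \<Rightarrow> real) \<Rightarrow> real"
    and l :: 'm
    and x0 y :: "real ^ 'm"
    and b :: "'m \<Rightarrow> 'm set \<Rightarrow> real"
  assumes "prob_space M"
    and "V \<in> borel_measurable M" and "Y \<in> borel_measurable M"
    and "gpd_copula (\<lambda>x. \<P>(\<omega> in M. V \<omega> \<le> x))"
    and "\<forall>i. x0 $ i < 0"
    and "pickands_dependence_function l D"
    and "\<forall>x\<in>{x0..0}. \<P>(\<omega> in M. V \<omega> \<le> x) = gpd_form l D x"
    and "copula C" and "\<forall>x. \<P>(\<omega> in M. Y \<omega> \<le> x) = C x"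
    and "prob_space.indep_var M borel Y borel V"
    and "\<forall>i. y $ i \<in> {-1..0}"
    and "\<P>(\<omega> in M. \<forall>i. Y \<omega> $ i > y $ i) > 0"
    and "Q = (\<lambda>\<omega>. \<chi> i. Y \<omega> $ i * indicator {\<omega>'. Y \<omega>' $ i \<le> y $ i} \<omega>
                     - y $ i * V \<omega> $ i * indicator {\<omega>'. Y \<omega>' $ i > y $ i} \<omega>)"
    and "b = (\<lambda>i K. \<P>(\<omega> in M. \<forall>j\<in>K. Y \<omega> $ j > y $ j) / (- (y $ i)))"
  shows "(\<forall>i. distr M borel (\<lambda>\<omega>. Q \<omega> $ i) = uniform_measure lborel {-1..0})
       \<and> gpd_copula (\<lambda>x. \<P>(\<omega> in M. Q \<omega> \<le> x))
       \<and> (\<forall>x. x \<le> y \<longrightarrow> \<P>(\<omega> in M. Q \<omega> \<le> x) = C x)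
       \<and> (\<forall>K. K \<noteq> {} \<longrightarrow>
            (\<forall>i\<in>K. b i K = \<P>(\<omega> in M. \<forall>j\<in>K. Y \<omega> $ j > y $ j) / \<P>(\<omega> in M. Y \<omega> $ i > y $ i)
                   \<and> b i K \<in> {0<..1})
          \<and> (\<forall>x. (\<forall>i. x $ i \<in> {max (y $ i) (x0 $ i)..0})
                 \<and> (\<forall>i\<in>K. x0 $ i \<le> x $ i / (- (y $ i))) \<longrightarrow>
               \<P>(\<omega> in M. \<forall>i\<in>K. Q \<omega> $ i \<ge> x $ i) = \<P>(\<omega> in M. \<forall>i\<in>K. V \<omega> $ i \<ge> b i K * x $ i)))"
proof -
  interpret prob_space M by fact
  have y: "\<And>i. y $ i \<in> {-1..0}" and x0: "\<And>i. x0 $ i < 0"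
    and pickands: "\<And>x. x \<in> {x0..0} \<Longrightarrow> prob {\<omega> \<in> space M. V \<omega> \<le> x} = gpd_form l D x"
    and C: "C = (\<lambda>x. prob {\<omega> \<in> space M. Y \<omega> \<le> x})"
    using assms by auto
  interpret V: copula_variable M V
    using assms(4) copula_iff_margins[OF assms(2)]
    by unfold_locales (auto simp: gpd_copula_def assms(2))
  interpret Y: copula_variable M Y
    using assms(8) copula_iff_margins[OF assms(3)]
    by unfold_locales (auto simp: C assms(3))
  interpret S: copula_splice M V Y y
    using assms(10,12) y by unfold_locales auto
  have Q: "Q = S.Q"
    unfolding assms(13) S.Q_def by (auto simp: fun_eq_iff vec_eq_iff indicator_def)
  have lower: "prob {\<omega> \<in> space M. S.Q \<omega> \<le> x} = C x" if "x \<le> y" for x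
    using S.prob_Q_le_lower[of UNIV x] that by (simp add: less_eq_vec_def C)
  have b_eq: "b i K = prob {\<omega> \<in> space M. \<forall>j\<in>K. Y \<omega> $ j > y $ j} / prob {\<omega> \<in> space M. Y \<omega> $ i > y $ i}"
    for i K by (simp add: assms(14) S.prob_exceed)
  have b_bounds: "b i K \<in> {0<..1}" if "i \<in> K" for i K
    using S.prob_exceed_mono[of "{i}" K] S.prob_exceed_pos[of K] S.prob_exceed_pos[of "{i}"] that
    by (simp add: b_eq)
  have survival: "prob {\<omega> \<in> space M. \<forall>i\<in>K. S.Q \<omega> $ i \<ge> x $ i} =
      prob {\<omega> \<in> space M. \<forall>i\<in>K. V \<omega> $ i \<ge> b i K * x $ i}"
    if K: "K \<noteq> {}" and x: "\<And>i. x $ i \<in> {max (y $ i) (x0 $ i)..0}"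
      and x0_le: "\<And>i. i \<in> K \<Longrightarrow> x0 $ i \<le> x $ i / - y $ i" for K x
  proof -
    have "(\<chi> i. x $ i / - y $ i) $ i \<in> {x0 $ i..0}" if "i \<in> K" for i
      using x0_le[OF that] x[of i] S.y_neg[of i] by (simp add: zero_le_divide_iff)
    \<comment> \<open>The scaling factor is the joint exceedance probability over \<open>K\<close>;
      multiplied by \<open>x $ i / - y $ i\<close> it gives \<open>b i K * x $ i\<close>.\<close>
    from V.prob_ge_scaleR[OF less_imp_le[OF x0] pickands K this]
    have "prob {\<omega> \<in> space M. \<forall>i\<in>K. prob {\<omega> \<in> space M. \<forall>j\<in>K. Y \<omega> $ j > y $ j} * (x $ i / - y $ i) \<le> V \<omega> $ i} =
        prob {\<omega> \<in> space M. \<forall>j\<in>K. Y \<omega> $ j > y $ j} * prob {\<omega> \<in> space M. \<forall>i\<in>K. x $ i / - y $ i \<le> V \<omega> $ i}"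
      by simp
    moreover have "prob {\<omega> \<in> space M. \<forall>i\<in>K. x $ i \<le> S.Q \<omega> $ i} =
        prob {\<omega> \<in> space M. \<forall>j\<in>K. Y \<omega> $ j > y $ j} * prob {\<omega> \<in> space M. \<forall>i\<in>K. x $ i / - y $ i \<le> V \<omega> $ i}"
      using x by (intro S.prob_Q_ge) auto
    ultimately show ?thesis by (simp add: assms(14))
  qed
  show ?thesis
    unfolding Q
    using S.distr_Q S.gpd_copula_Q[OF assms(4) x0 pickands] lower b_eq b_bounds survival
    by (intro conjI allI impI ballI) (blast | simp)+
qed

end
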